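(* Let $R$ be a ring of characteristic $p>0$, let $s,t$ be real numbers with $1\leq t<s$, and let $I$ be an ideal of $R$. If $r\in\mathbb{N}$ satisfies $r\geq \frac{(\mu(I)-1)(s-t)}{t(s-1)}$, then for all $n\in\mathbb{N}$, $\left(I^{n+r}\right)^{\{t\}}\subseteq \left(I^n\right)^{\{s\}}$.
   Context: All rings are commutative and noetherian. $\mu(I)$ denotes the minimal number of generators of $I$. $\mathbb{N}$ is the set of nonnegative integers. $R^\circ$ denotes the set of elements of $R$ lying in no minimal prime of $R$. The letter $q$ denotes positive integer powers of $p$, and $q\gg 0$ means all sufficiently large such powers. $I^{[q]}=(f^q\mid f\in I)$ is the $q$th Frobenius power of $I$. For a real number $s\geq 1$, $I^{(s,q)}=I^{\lceil sq\rceil}+I^{[q]}$. The weak $s$-closure $I^{\{s\}}$ of an ideal $I$ is the ideal of all $x\in R$ for which there exists $c\in R^\circ$ such that $cx^q\in I^{(s,q)}$ for all $q\gg 0$. *)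

theory Defs
  imports Complex_Main "HOL-Algebra.Algebra"
begin

text \<open>The additive order of \<open>1\<close>; it is \<open>0\<close> in characteristic zero.\<close>

definition ring_char :: "('a, 'b) ring_scheme \<Rightarrow> nat"
  where "ring_char R = group.ord (add_monoid R) \<one>\<^bsub>R\<^esub>"

definition min_num_gens :: "('a, 'b) ring_scheme \<Rightarrow> 'a set \<Rightarrow> nat"
  where "min_num_gens R I =
    (LEAST m. \<exists>S. S \<subseteq> carrier R \<and> finite S \<and> card S = m \<and> I = Idl\<^bsub>R\<^esub> S)"

definition minimal_prime :: "('a, 'b) ring_scheme \<Rightarrow> 'a set \<Rightarrow> bool"
  where "minimal_prime R P \<longleftrightarrow>
    primeideal P R \<and> (\<forall>Q. primeideal Q R \<and> Q \<subseteq> P \<longrightarrow> Q = P)"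

definition off_minimal_primes :: "('a, 'b) ring_scheme \<Rightarrow> 'a set"
  where "off_minimal_primes R = {c \<in> carrier R. \<forall>P. minimal_prime R P \<longrightarrow> c \<notin> P}"

definition frobenius_power :: "('a, 'b) ring_scheme \<Rightarrow> 'a set \<Rightarrow> nat \<Rightarrow> 'a set"
  where "frobenius_power R I q = Idl\<^bsub>R\<^esub> {f [^]\<^bsub>R\<^esub> q | f. f \<in> I}"

text \<open>Ideal powers are powers in the monoid \<^const>\<open>ideals_set\<close>, so that
  \<open>I [^]\<^bsub>ideals_set R\<^esub> 0 = carrier R\<close>.
  For \<open>s \<ge> 1\<close> the conversion by \<^const>\<open>nat\<close> is exact.\<close>

definition mixed_power :: "('a, 'b) ring_scheme \<Rightarrow> real \<Rightarrow> nat \<Rightarrow> 'a set \<Rightarrow> 'a set"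
  where "mixed_power R s q I =
    I [^]\<^bsub>ideals_set R\<^esub> nat \<lceil>s * real q\<rceil> <+>\<^bsub>R\<^esub> frobenius_power R I q"

text \<open>\<open>q\<close> ranges over \<open>ring_char R ^ e\<close>, meaningful when the characteristic is prime;
  \<open>q \<gg> 0\<close> is rendered as ``for all sufficiently large \<open>e\<close>''.\<close>

definition weak_closure :: "('a, 'b) ring_scheme \<Rightarrow> real \<Rightarrow> 'a set \<Rightarrow> 'a set"
  where "weak_closure R s I =
    {x \<in> carrier R. \<exists>c \<in> off_minimal_primes R.
       \<forall>\<^sub>F e in sequentially.
         c \<otimes>\<^bsub>R\<^esub> x [^]\<^bsub>R\<^esub> (ring_char R ^ e) \<in> mixed_power R s (ring_char R ^ e) I}"

end

theory Submission
  imports Defs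
begin

text \<open>
  Put \<open>m = \<mu>(I)\<close>. The same multiplier \<open>c\<close> works for both closures, because for all large \<open>q\<close>
  there is already an inclusion of mixed powers
  \<open>(I\<^bsup>n+r\<^esup>)\<^bsup>(t,q)\<^esup> \<subseteq> (I\<^bsup>n\<^esup>)\<^bsup>(s,q)\<^esup>\<close>.
  The Frobenius summands compare trivially, since \<open>I\<^bsup>n+r\<^esup> \<subseteq> I\<^bsup>n\<^esup>\<close>. The other summand is the
  ordinary power of \<open>I\<close> with exponent \<open>N = (n+r)\<lceil>tq\<rceil>\<close>, and there are two ways to absorb it.

  If \<open>t(n+r) > ns\<close>, then for large \<open>q\<close> the slack \<open>(t(n+r) - ns)q\<close> exceeds the rounding error,
  which is at most \<open>n\<close>; so \<open>N \<ge> n\<lceil>sq\<rceil>\<close> and \<open>I\<^bsup>N\<^esup> \<subseteq> (I\<^bsup>n\<^esup>)\<^bsup>\<lceil>sq\<rceil>\<^esup>\<close>.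

  If \<open>t(n+r) \<ge> m + n - 1\<close>, then \<open>N \<ge> (m+n-1)q\<close>. Dividing the exponents of a monomial of degree
  \<open>N\<close> in \<open>m\<close> generators by \<open>q\<close> leaves remainders of total at most \<open>m(q-1)\<close>, so the quotients have
  total greater than \<open>n - 1\<close> when \<open>m \<ge> 1\<close>. The monomial is therefore divisible by the \<open>q\<close>th power of
  a monomial of degree at least \<open>n\<close>, and
  \<open>I\<^bsup>N\<^esup> \<subseteq> (I\<^bsup>n\<^esup>)\<^bsup>[q]\<^esup>\<close> (lemma \<open>ideal_pow_subset_frobenius_power\<close>).

  One of the two always happens: if both fail, adding \<open>s - t > 0\<close> times
  \<open>tr < m - 1 - n(t-1)\<close> to \<open>t - 1 \<ge> 0\<close> times \<open>tr \<le> n(s-t)\<close> cancels \<open>n\<close> and leaves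
  \<open>tr(s-1) < (m-1)(s-t)\<close>, against the hypothesis on \<open>r\<close> (lemma \<open>exponent_dichotomy\<close>).
\<close>

section \<open>Powers of ideals\<close>

context cring
begin

lemma ideal_pow_ideal:
  assumes "ideal I R"
  shows "ideal (I [^]\<^bsub>ideals_set R\<^esub> (N::nat)) R"
  using monoid.nat_pow_closed[OF comm_monoid.axioms(1)[OF ideals_set_is_comm_monoid], of I N] assms
  by (simp add: ideals_set_def)

lemma ideal_pow_Suc:
  "I [^]\<^bsub>ideals_set R\<^esub> Suc N = (I [^]\<^bsub>ideals_set R\<^esub> N) \<cdot> I"
  by (simp add: ideals_set_def)

lemma ideal_pow_pow:
  assumes "ideal I R"
  shows "(I [^]\<^bsub>ideals_set R\<^esub> (M::nat)) [^]\<^bsub>ideals_set R\<^esub> (N::nat) = I [^]\<^bsub>ideals_set R\<^esub> (M * N)"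
  using monoid.nat_pow_pow[OF comm_monoid.axioms(1)[OF ideals_set_is_comm_monoid], of I] assms
  by (simp add: ideals_set_def)

lemma ideal_pow_antimono:
  assumes "ideal I R" and "M \<le> N"
  shows "I [^]\<^bsub>ideals_set R\<^esub> N \<subseteq> I [^]\<^bsub>ideals_set R\<^esub> (M::nat)"
  using assms(2)
proof (induction rule: dec_induct)
  case (step k)
  have "I [^]\<^bsub>ideals_set R\<^esub> Suc k \<subseteq> I [^]\<^bsub>ideals_set R\<^esub> k"
    using ideal_prod_inter[OF ideal_pow_ideal[OF assms(1)] assms(1)] unfolding ideal_pow_Suc by blast
  with step show ?case by blast
qed simp

lemma pow_mem_ideal_pow:
  assumes "ideal I R" "x \<in> I"
  shows "x [^] (b::nat) \<in> I [^]\<^bsub>ideals_set R\<^esub> b"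
proof (induction b)
  case 0
  show ?case by (simp add: ideals_set_def)
next
  case (Suc b)
  then show ?case unfolding ideal_pow_Suc using assms(2) by (simp add: ideal_prod.prod)
qed

lemma ideal_pow_mult_mem:
  assumes "ideal I R" "x \<in> I [^]\<^bsub>ideals_set R\<^esub> (M::nat)" "y \<in> I [^]\<^bsub>ideals_set R\<^esub> (N::nat)"
  shows "x \<otimes> y \<in> I [^]\<^bsub>ideals_set R\<^esub> (M + N)"
proof -
  have "I [^]\<^bsub>ideals_set R\<^esub> (M + N) = (I [^]\<^bsub>ideals_set R\<^esub> M) \<cdot> (I [^]\<^bsub>ideals_set R\<^esub> N)"
    using monoid.nat_pow_mult[OF comm_monoid.axioms(1)[OF ideals_set_is_comm_monoid], of I M N] assms(1)
    by (simp add: ideals_set_def)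
  then show ?thesis using assms by (simp add: ideal_prod.prod)
qed

lemma monomial_mem_ideal_pow:
  fixes b :: "'a \<Rightarrow> nat"
  assumes I: "ideal I R" and "finite S" and "S \<subseteq> I"
  shows "(\<Otimes>g\<in>S. g [^] b g) \<in> I [^]\<^bsub>ideals_set R\<^esub> (\<Sum>g\<in>S. b g)"
  using assms(2,3)
proof (induction S rule: finite_induct)
  case empty
  show ?case by (simp add: ideals_set_def)
next
  case (insert g S)
  have carr: "insert g S \<subseteq> carrier R" using insert.prems ideal.Icarr[OF I] by blast
  have "(\<Otimes>g\<in>insert g S. g [^] b g) = g [^] b g \<otimes> (\<Otimes>g\<in>S. g [^] b g)"
    using carr insert.hyps by (intro finprod_insert) auto
  then show ?case
    using ideal_pow_mult_mem[OF I pow_mem_ideal_pow[OF I] insert.IH, of g "b g"] insert by simp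
qed

text \<open>
  The colon ideal \<open>(J : x)\<close>. It lets a containment of products in \<open>J\<close> be checked on generators,
  one factor at a time.
\<close>

lemma colon_ideal:
  assumes J: "ideal J R" and x: "x \<in> carrier R"
  shows "ideal {y \<in> carrier R. x \<otimes> y \<in> J} R"
proof (rule idealI)
  interpret J: ideal J R by (rule J)
  show "ring R" by (rule ring_axioms)
  show "subgroup {y \<in> carrier R. x \<otimes> y \<in> J} (add_monoid R)"
  proof (rule add.subgroupI)
    have "x \<otimes> \<zero> \<in> J" using x by simp
    then show "{y \<in> carrier R. x \<otimes> y \<in> J} \<noteq> {}" by blast
  next
    fix a assume "a \<in> {y \<in> carrier R. x \<otimes> y \<in> J}"
    then show "\<ominus> a \<in> {y \<in> carrier R. x \<otimes> y \<in> J}" using x by (simp add: r_minus)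
  next
    fix a b assume "a \<in> {y \<in> carrier R. x \<otimes> y \<in> J}" "b \<in> {y \<in> carrier R. x \<otimes> y \<in> J}"
    then show "a \<oplus> b \<in> {y \<in> carrier R. x \<otimes> y \<in> J}" using x by (simp add: r_distr)
  qed auto
  fix a y assume a: "a \<in> {y \<in> carrier R. x \<otimes> y \<in> J}" and y: "y \<in> carrier R"
  then have "x \<otimes> (y \<otimes> a) = y \<otimes> (x \<otimes> a)" "x \<otimes> (a \<otimes> y) = (x \<otimes> a) \<otimes> y"
    using x by (simp_all add: m_ac)
  then show "y \<otimes> a \<in> {y \<in> carrier R. x \<otimes> y \<in> J}" "a \<otimes> y \<in> {y \<in> carrier R. x \<otimes> y \<in> J}"
    using a y by (simp_all add: J.I_l_closed J.I_r_closed)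
qed

lemma ideal_prod_genideal_subset:
  assumes A: "A \<subseteq> carrier R" and B: "B \<subseteq> carrier R" and J: "ideal J R"
    and AB: "\<And>a b. a \<in> A \<Longrightarrow> b \<in> B \<Longrightarrow> a \<otimes> b \<in> J"
  shows "(Idl A) \<cdot> (Idl B) \<subseteq> J"
proof -
  have right: "a \<otimes> y \<in> J" if a: "a \<in> A" and y: "y \<in> Idl B" for a y
  proof -
    have "a \<in> carrier R" using a A by blast
    from colon_ideal[OF J this] have "Idl B \<subseteq> {y \<in> carrier R. a \<otimes> y \<in> J}"
      by (rule genideal_minimal) (use a B AB in auto)
    with y show ?thesis by blast
  qed
  have "x \<otimes> y \<in> J" if x: "x \<in> Idl A" and y: "y \<in> Idl B" for x y
  proof -
    have yc: "y \<in> carrier R" using ideal.Icarr[OF genideal_ideal[OF B] y] .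
    from colon_ideal[OF J yc] have "Idl A \<subseteq> {x \<in> carrier R. y \<otimes> x \<in> J}"
    proof (rule genideal_minimal, intro subsetI CollectI conjI)
      fix a assume a: "a \<in> A"
      then show ac: "a \<in> carrier R" using A by blast
      show "y \<otimes> a \<in> J" using right[OF a y] m_comm[OF ac yc] by simp
    qed
    then have "x \<in> carrier R" "y \<otimes> x \<in> J" using x by auto
    then show ?thesis using m_comm[OF _ yc] by simp
  qed
  then show ?thesis
    using genideal_minimal[OF J, of "(Idl A) <#> (Idl B)"]
    unfolding ideal_prod_eq_genideal[OF genideal_ideal[OF A] genideal_ideal[OF B]] set_mult_def
    by blast
qed

text \<open>
  Raising the exponent by one multiplies a generating monomial by one element of \<open>S\<close>, which
  raises one entry of its exponent function. Indexing by exponent functions rather than by words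
  in \<open>S\<close> makes division with remainder by \<open>q\<close> available entry by entry.
\<close>

lemma ideal_pow_subset_monomials:
  assumes S: "finite S" "S \<subseteq> carrier R"
  shows "(Idl S) [^]\<^bsub>ideals_set R\<^esub> (N::nat)
           \<subseteq> Idl {\<Otimes>g\<in>S. g [^] a g | a :: 'a \<Rightarrow> nat. (\<Sum>g\<in>S. a g) = N}"
    (is "_ \<subseteq> Idl (?M N)")
proof (induction N)
  case 0
  have "(\<Otimes>g\<in>S. g [^] (0::nat)) \<in> ?M 0"
    by (intro CollectI exI[of _ "\<lambda>_. 0"]) simp
  then have "\<one> \<in> ?M 0" by simp
  moreover have "?M 0 \<subseteq> carrier R" using S by (auto intro!: finprod_closed)
  ultimately have "\<one> \<in> Idl (?M 0)" "ideal (Idl (?M 0)) R"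
    using genideal_self genideal_ideal by blast+
  then have "Idl (?M 0) = carrier R" using ideal.one_imp_carrier by blast
  then show ?case by (simp add: ideals_set_def)
next
  case (Suc N)
  have Mc: "?M k \<subseteq> carrier R" for k using S by (auto intro!: finprod_closed)
  let ?J = "Idl (?M (Suc N))"
  have J: "ideal ?J R" using genideal_ideal[OF Mc] .
  have mono_gen: "x \<otimes> h \<in> ?J" if x: "x \<in> ?M N" and h: "h \<in> S" for x h
  proof -
    obtain a :: "'a \<Rightarrow> nat" where a: "x = (\<Otimes>g\<in>S. g [^] a g)" "(\<Sum>g\<in>S. a g) = N" using x by blast
    let ?d = "\<lambda>g. if g = h then 1 else 0 :: nat"
    have "h = (\<Otimes>g\<in>S. if h = g then g else \<one>)"
      using S(2) by (intro finprod_singleton[OF h S(1), symmetric]) auto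
    also have "\<dots> = (\<Otimes>g\<in>S. g [^] ?d g)"
      using S(2) by (intro finprod_cong') (auto simp: subset_iff)
    finally have "x \<otimes> h = (\<Otimes>g\<in>S. g [^] a g) \<otimes> (\<Otimes>g\<in>S. g [^] ?d g)" using a by simp
    also have "\<dots> = (\<Otimes>g\<in>S. g [^] a g \<otimes> g [^] ?d g)"
      using S(2) by (intro finprod_multf[symmetric]) auto
    also have "\<dots> = (\<Otimes>g\<in>S. g [^] (a g + ?d g))"
      using S(2) by (intro finprod_cong') (auto simp: nat_pow_mult subset_iff)
    finally have "x \<otimes> h = (\<Otimes>g\<in>S. g [^] (a g + ?d g))" .
    moreover have "(\<Sum>g\<in>S. a g + ?d g) = Suc N"
      using a(2) h S(1) by (simp add: sum.distrib)
    ultimately have "x \<otimes> h \<in> ?M (Suc N)"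
      by (intro CollectI exI[of _ "\<lambda>g. a g + ?d g"] conjI)
    then show ?thesis using genideal_self[OF Mc] by blast
  qed
  have "(Idl (?M N)) \<cdot> (Idl S) \<subseteq> ?J"
    by (rule ideal_prod_genideal_subset[OF Mc S(2) J mono_gen])
  moreover have "((Idl S) [^]\<^bsub>ideals_set R\<^esub> N) \<cdot> (Idl S) \<subseteq> (Idl (?M N)) \<cdot> (Idl S)"
  proof
    fix z assume "z \<in> ((Idl S) [^]\<^bsub>ideals_set R\<^esub> N) \<cdot> (Idl S)"
    then show "z \<in> (Idl (?M N)) \<cdot> (Idl S)"
    proof (induction rule: ideal_prod.induct)
      case (prod i j)
      then show ?case using subsetD[OF Suc.IH] by (intro ideal_prod.prod)
    qed (rule ideal_prod.sum)
  qed
  ultimately show ?case unfolding ideal_pow_Suc by (rule order_trans[rotated])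
qed

section \<open>Ordinary powers inside Frobenius powers\<close>

lemma finprod_pow:
  assumes "finite S" "f \<in> S \<rightarrow> carrier R"
  shows "(\<Otimes>g\<in>S. f g [^] (q::nat)) = (\<Otimes>g\<in>S. f g) [^] q"
  using assms
proof (induction S rule: finite_induct)
  case (insert x S)
  then show ?case by (simp add: Pi_iff nat_pow_distrib)
qed simp

lemma frobenius_power_gens_carrier:
  assumes "ideal I R"
  shows "{f [^] (q::nat) | f. f \<in> I} \<subseteq> carrier R"
  using ideal.Icarr[OF assms] by auto

lemma frobenius_power_ideal:
  assumes "ideal I R"
  shows "ideal (frobenius_power R I q) R"
  unfolding frobenius_power_def using genideal_ideal[OF frobenius_power_gens_carrier[OF assms]] .

lemma frobenius_power_mono:
  assumes "ideal J R" "I \<subseteq> J"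
  shows "frobenius_power R I q \<subseteq> frobenius_power R J q"
  unfolding frobenius_power_def using assms(2)
  by (intro subset_Idl_subset[OF frobenius_power_gens_carrier[OF assms(1)]]) blast

text \<open>
  Split a monomial of degree \<open>N\<close> as \<open>f\<^sup>q\<close> times a remainder, by dividing each exponent by \<open>q\<close>. The
  remainder has degree at most \<open>card S * (q - 1)\<close>, so \<open>q * deg f > (n - 1) q\<close> by the bound on \<open>N\<close>,
  that is, \<open>deg f \<ge> n\<close>. The bound is written with \<open>+ q\<close> on the right so that it also reads
  correctly over the natural numbers for \<open>n = 0\<close>.
\<close>

lemma ideal_pow_subset_frobenius_power:
  assumes S: "finite S" "S \<subseteq> carrier R" and q: "0 < q"
    and N: "n * q + card S * (q - 1) < N + q"
  shows "(Idl S) [^]\<^bsub>ideals_set R\<^esub> N \<subseteq> frobenius_power R ((Idl S) [^]\<^bsub>ideals_set R\<^esub> n) q"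
    (is "_ \<subseteq> ?F")
proof -
  have I: "ideal (Idl S) R" using genideal_ideal[OF S(2)] .
  have In: "ideal ((Idl S) [^]\<^bsub>ideals_set R\<^esub> n) R" by (rule ideal_pow_ideal[OF I])
  interpret F: ideal ?F R by (rule frobenius_power_ideal[OF In])
  have "(\<Otimes>g\<in>S. g [^] a g) \<in> ?F" if a: "(\<Sum>g\<in>S. a g) = N" for a :: "'a \<Rightarrow> nat"
  proof -
    let ?f = "\<Otimes>g\<in>S. g [^] (a g div q)"
    have "(\<Sum>g\<in>S. a g) = (\<Sum>g\<in>S. a g div q * q + a g mod q)" by simp
    also have "\<dots> = (\<Sum>g\<in>S. a g div q) * q + (\<Sum>g\<in>S. a g mod q)"
      by (simp only: sum.distrib sum_distrib_right)
    also have "(\<Sum>g\<in>S. a g mod q) \<le> (\<Sum>g\<in>S. q - 1)"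
    proof (rule sum_mono)
      fix g show "a g mod q \<le> q - 1" using mod_less_divisor[OF q, of "a g"] by linarith
    qed
    finally have "N \<le> (\<Sum>g\<in>S. a g div q) * q + card S * (q - 1)" using a by simp
    with N have "n * q < ((\<Sum>g\<in>S. a g div q) + 1) * q" by (simp add: algebra_simps)
    then have "n < (\<Sum>g\<in>S. a g div q) + 1" unfolding mult_less_cancel2 by (rule conjunct2)
    then have deg: "n \<le> (\<Sum>g\<in>S. a g div q)" by simp
    have "?f \<in> (Idl S) [^]\<^bsub>ideals_set R\<^esub> (\<Sum>g\<in>S. a g div q)"
      using monomial_mem_ideal_pow[OF I S(1) genideal_self[OF S(2)]] .
    then have "?f \<in> (Idl S) [^]\<^bsub>ideals_set R\<^esub> n" using ideal_pow_antimono[OF I deg] by blast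
    then have f: "?f [^] q \<in> ?F"
      unfolding frobenius_power_def
      using genideal_self[OF frobenius_power_gens_carrier[OF In, of q]] by blast
    have "(\<Otimes>g\<in>S. g [^] a g) = (\<Otimes>g\<in>S. (g [^] (a g div q)) [^] q \<otimes> g [^] (a g mod q))"
    proof (rule finprod_cong')
      fix g assume "g \<in> S"
      then have "g \<in> carrier R" using S(2) by blast
      then show "g [^] a g = (g [^] (a g div q)) [^] q \<otimes> g [^] (a g mod q)"
        by (simp add: nat_pow_pow nat_pow_mult)
    qed (use S(2) in auto)
    also have "\<dots> = (\<Otimes>g\<in>S. (g [^] (a g div q)) [^] q) \<otimes> (\<Otimes>g\<in>S. g [^] (a g mod q))"
      using S(2) by (intro finprod_multf) auto
    also have "\<dots> = ?f [^] q \<otimes> (\<Otimes>g\<in>S. g [^] (a g mod q))"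
      using S by (subst finprod_pow) auto
    finally have "(\<Otimes>g\<in>S. g [^] a g) = ?f [^] q \<otimes> (\<Otimes>g\<in>S. g [^] (a g mod q))" .
    moreover have "(\<Otimes>g\<in>S. g [^] (a g mod q)) \<in> carrier R"
      using S(2) by (intro finprod_closed) auto
    ultimately show ?thesis using F.I_r_closed[OF f] by simp
  qed
  then have "Idl {\<Otimes>g\<in>S. g [^] a g | a :: 'a \<Rightarrow> nat. (\<Sum>g\<in>S. a g) = N} \<subseteq> ?F"
    by (intro genideal_minimal[OF F.ideal_axioms]) blast
  with ideal_pow_subset_monomials[OF S] show ?thesis by blast
qed

section \<open>Comparing mixed powers\<close>

lemma ideal_sum_subset:
  assumes "ideal K R" "A \<subseteq> K" "B \<subseteq> K"
  shows "A <+>\<^bsub>R\<^esub> B \<subseteq> K"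
  using assms additive_subgroup.a_closed[OF ideal.axioms(1)[OF assms(1)]]
  by (auto simp: set_add_def')

lemma subset_mixed_power:
  assumes "ideal I R"
  shows "I [^]\<^bsub>ideals_set R\<^esub> nat \<lceil>s * real q\<rceil> \<subseteq> mixed_power R s q I"
    and "frobenius_power R I q \<subseteq> mixed_power R s q I"
    and "ideal (mixed_power R s q I) R"
proof -
  have *: "ideal (I [^]\<^bsub>ideals_set R\<^esub> nat \<lceil>s * real q\<rceil>) R" "ideal (frobenius_power R I q) R"
    using ideal_pow_ideal frobenius_power_ideal assms by auto
  then have eq: "mixed_power R s q I
      = Idl (I [^]\<^bsub>ideals_set R\<^esub> nat \<lceil>s * real q\<rceil> \<union> frobenius_power R I q)"
    unfolding mixed_power_def by (simp add: union_genideal)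
  have "I [^]\<^bsub>ideals_set R\<^esub> nat \<lceil>s * real q\<rceil> \<union> frobenius_power R I q \<subseteq> carrier R"
    using *[THEN ideal.Icarr] by auto
  from genideal_self[OF this]
  show "I [^]\<^bsub>ideals_set R\<^esub> nat \<lceil>s * real q\<rceil> \<subseteq> mixed_power R s q I"
    and "frobenius_power R I q \<subseteq> mixed_power R s q I"
    unfolding eq by auto
  show "ideal (mixed_power R s q I) R" unfolding mixed_power_def using add_ideals * by blast
qed

end

text \<open>
  The first alternative is strict on purpose: a positive gap, multiplied by \<open>q\<close>, outgrows the
  rounding in \<open>n\<lceil>sq\<rceil>\<close>, whereas equality would not absorb it. The boundary case
  \<open>t(n+r) = ns\<close> can be left to the second alternative because that inequality enters the
  weighted sum with the positive weight \<open>s - t\<close>, which alone makes the sum strict.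
\<close>

lemma exponent_dichotomy:
  fixes s t m :: real and n r :: nat
  assumes "1 \<le> t" "t < s" and r: "real r \<ge> (m - 1) * (s - t) / (t * (s - 1))"
  shows "n * s < t * (n + r) \<or> m + n - 1 \<le> t * (n + r)"
proof (rule ccontr)
  assume "\<not> ?thesis"
  then have 1: "t * (n + r) \<le> n * s" and 2: "t * (n + r) < m + n - 1" by auto
  have "(s - t) * (t * (n + r)) < (s - t) * (m + n - 1)"
    using 2 assms(2) by (intro mult_strict_left_mono) auto
  moreover have "(t - 1) * (t * (n + r)) \<le> (t - 1) * (n * s)"
    using 1 assms(1) by (intro mult_left_mono) auto
  ultimately have "r * (t * (s - 1)) < (m - 1) * (s - t)" by (simp add: algebra_simps)
  moreover have "0 < t * (s - 1)" using assms by simp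
  ultimately show False using r by (simp add: pos_divide_le_eq)
qed

text \<open>
  The asymptotic gap \<open>t(n+r) > ns\<close> enters here in a form for a single \<open>q\<close>: the slack
  \<open>(t(n+r) - ns)q\<close> has to cover the \<open>n\<close> lost when the \<open>n\<close> copies of \<open>sq\<close> are rounded up.
  Rounding up \<open>tq\<close> only enlarges the exponent on the left, so it costs nothing.
\<close>

lemma (in cring) mixed_power_subset:
  fixes s t :: real and n r q :: nat
  assumes S: "finite S" "S \<subseteq> carrier R" and "1 \<le> t" and q: "0 < q"
    and alt: "n \<le> (t * (n + r) - n * s) * q \<or> card S + real n - 1 \<le> t * (n + r)"
  shows "mixed_power R t q ((Idl S) [^]\<^bsub>ideals_set R\<^esub> (n + r))
           \<subseteq> mixed_power R s q ((Idl S) [^]\<^bsub>ideals_set R\<^esub> n)"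
proof -
  have I: "ideal (Idl S) R" using genideal_ideal[OF S(2)] .
  have In: "ideal ((Idl S) [^]\<^bsub>ideals_set R\<^esub> k) R" for k :: nat by (rule ideal_pow_ideal[OF I])
  let ?N = "(n + r) * nat \<lceil>t * real q\<rceil>"
  have "t * q \<le> real (nat \<lceil>t * real q\<rceil>)" by (rule real_nat_ceiling_ge)
  then have "real (n + r) * (t * q) \<le> real (n + r) * real (nat \<lceil>t * real q\<rceil>)"
    by (intro mult_left_mono) auto
  then have N: "t * (n + r) * q \<le> real ?N" by (simp add: mult_ac)
  have "(Idl S) [^]\<^bsub>ideals_set R\<^esub> ?N
          \<subseteq> mixed_power R s q ((Idl S) [^]\<^bsub>ideals_set R\<^esub> n)"
    using alt
  proof
    assume slack: "n \<le> (t * (n + r) - n * s) * q"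
    have "n * nat \<lceil>s * real q\<rceil> \<le> ?N"
    proof (cases "0 \<le> s * q")
      case True
      then have "real (nat \<lceil>s * real q\<rceil>) \<le> s * q + 1" by linarith
      then have "real n * real (nat \<lceil>s * real q\<rceil>) \<le> n * (s * q + 1)"
        by (intro mult_left_mono) auto
      also have "\<dots> \<le> real ?N" using slack N by (simp add: algebra_simps)
      finally have "real (n * nat \<lceil>s * real q\<rceil>) \<le> real ?N" by simp
      then show ?thesis unfolding of_nat_le_iff .
    qed simp
    then have "(Idl S) [^]\<^bsub>ideals_set R\<^esub> ?N
        \<subseteq> ((Idl S) [^]\<^bsub>ideals_set R\<^esub> n) [^]\<^bsub>ideals_set R\<^esub> nat \<lceil>s * real q\<rceil>"
      unfolding ideal_pow_pow[OF I] by (rule ideal_pow_antimono[OF I])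
    then show ?thesis using subset_mixed_power(1)[OF In] by blast
  next
    assume many: "card S + real n - 1 \<le> t * (n + r)"
    have "n * q + card S * (q - 1) < ?N + q"
    proof (cases "card S = 0")
      \<comment> \<open>For \<open>I = 0\<close> the assumed bound yields only \<open>N \<ge> (n - 1) q\<close>; here \<open>t \<ge> 1\<close> gives
        \<open>N \<ge> n q\<close>.\<close>
      case True
      have "real n * q \<le> t * (n + r) * q"
        using mult_mono[of 1 t "real n" "real (n + r)"] \<open>1 \<le> t\<close> by (intro mult_right_mono) auto
      also note N
      finally have "real (n * q) \<le> real ?N" by simp
      then have "n * q \<le> ?N" unfolding of_nat_le_iff .
      then show ?thesis using True q by simp
    next
      case False
      have "(card S + real n - 1) * q \<le> t * (n + r) * q"
        using many by (intro mult_right_mono) auto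
      also note N
      finally have "real (card S * q + n * q) \<le> real (?N + q)" by (simp add: algebra_simps)
      then have "card S * q + n * q \<le> ?N + q" unfolding of_nat_le_iff .
      moreover have "card S * (q - 1) < card S * q" using False q by simp
      ultimately show ?thesis by linarith
    qed
    from ideal_pow_subset_frobenius_power[OF S q this]
    show ?thesis using subset_mixed_power(2)[OF In] by blast
  qed
  moreover have "frobenius_power R ((Idl S) [^]\<^bsub>ideals_set R\<^esub> (n + r)) q
          \<subseteq> mixed_power R s q ((Idl S) [^]\<^bsub>ideals_set R\<^esub> n)"
    using frobenius_power_mono[OF In ideal_pow_antimono[OF I, of n "n + r"]]
      subset_mixed_power(2)[OF In] by fastforce
  ultimately show ?thesis
    unfolding mixed_power_def[of R t] ideal_pow_pow[OF I]
    by (rule ideal_sum_subset[OF subset_mixed_power(3)[OF In]])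
qed

section \<open>Weak closures\<close>

lemma (in noetherian_ring) min_num_gens_attained:
  assumes "ideal I R"
  obtains S where "S \<subseteq> carrier R" "finite S" "card S = min_num_gens R I" "I = Idl S"
proof -
  have "\<exists>m S. S \<subseteq> carrier R \<and> finite S \<and> card S = m \<and> I = Idl S"
    using finetely_gen[OF assms] by blast
  from LeastI_ex[OF this] show ?thesis using that unfolding min_num_gens_def by blast
qed

theorem theorem5p1:
  fixes R :: "('a, 'b) ring_scheme" (structure)
    and p r :: nat and s t :: real and I :: "'a set"
  assumes "cring R" and "noetherian_ring R"
    and "Factorial_Ring.prime p" and "ring_char R = p"
    and "1 \<le> t" and "t < s"
    and "ideal I R"
    and "real r \<ge> (real (min_num_gens R I) - 1) * (s - t) / (t * (s - 1))"
  shows "\<forall>n::nat. weak_closure R t (I [^]\<^bsub>ideals_set R\<^esub> (n + r))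
                  \<subseteq> weak_closure R s (I [^]\<^bsub>ideals_set R\<^esub> n)"
proof
  fix n :: nat
  interpret cring R by fact
  obtain S where S: "S \<subseteq> carrier R" "finite S" "card S = min_num_gens R I" "I = Idl S"
    using noetherian_ring.min_num_gens_attained[OF assms(2,7)] .
  have p: "1 < p" using assms(3) prime_gt_1_nat by blast
  have "\<forall>\<^sub>F e in sequentially.
      n \<le> (t * (n + r) - n * s) * real (p ^ e) \<or> card S + real n - 1 \<le> t * (n + r)"
    using exponent_dichotomy[OF assms(5,6,8), of n]
  proof
    assume "n * s < t * (n + r)"
    moreover have "filterlim (\<lambda>e. real p ^ e) at_top sequentially"
      using p by (intro filterlim_at_infinity_imp_filterlim_at_top
          filterlim_realpow_sequentially_gt1 always_eventually) auto
    ultimately have "filterlim (\<lambda>e. (t * (n + r) - n * s) * real p ^ e) at_top sequentially"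
      by (intro filterlim_tendsto_pos_mult_at_top[OF tendsto_const]) auto
    then have "\<forall>\<^sub>F e in sequentially. real n \<le> (t * (n + r) - n * s) * real p ^ e"
      by (simp add: filterlim_at_top)
    then show ?thesis by eventually_elim simp
  qed (simp add: S(3))
  then have incl: "\<forall>\<^sub>F e in sequentially.
      mixed_power R t (ring_char R ^ e) (I [^]\<^bsub>ideals_set R\<^esub> (n + r))
        \<subseteq> mixed_power R s (ring_char R ^ e) (I [^]\<^bsub>ideals_set R\<^esub> n)"
    unfolding assms(4) S(4)
    by eventually_elim (use mixed_power_subset[OF S(2,1) assms(5)] p in simp)
  show "weak_closure R t (I [^]\<^bsub>ideals_set R\<^esub> (n + r))
          \<subseteq> weak_closure R s (I [^]\<^bsub>ideals_set R\<^esub> n)"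
  proof
    fix x assume "x \<in> weak_closure R t (I [^]\<^bsub>ideals_set R\<^esub> (n + r))"
    then obtain c where x: "x \<in> carrier R" and c: "c \<in> off_minimal_primes R"
      and ev: "\<forall>\<^sub>F e in sequentially. c \<otimes> x [^] (ring_char R ^ e)
              \<in> mixed_power R t (ring_char R ^ e) (I [^]\<^bsub>ideals_set R\<^esub> (n + r))"
      unfolding weak_closure_def by blast
    from ev incl have "\<forall>\<^sub>F e in sequentially. c \<otimes> x [^] (ring_char R ^ e)
              \<in> mixed_power R s (ring_char R ^ e) (I [^]\<^bsub>ideals_set R\<^esub> n)"
      by eventually_elim blast
    with x c show "x \<in> weak_closure R s (I [^]\<^bsub>ideals_set R\<^esub> n)"
      unfolding weak_closure_def by blast
  qed
qed

end
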